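(* Let $F:\mathcal H\to\mathcal H$ satisfy $F(0)=0$ and be globally Lipschitz continuous, i.e. there exists $\gamma>0$ such that $\|F(U_1)-F(U_2)\|_{\mathcal H}\le\gamma\|U_1-U_2\|_{\mathcal H}$ for all $U_1,U_2\in\mathcal H$. Then for any initial datum $U_0\in\mathcal H$ and any $f\in C([0,\tau];\mathcal H)$ there exists a unique (mild) solution $U\in C([0,+\infty),\mathcal H)$ of $$U_t(t)=\mathcal A U(t)+F(U(t))+k\mathcal B U(t-\tau)\ \text{ in }(0,+\infty),\qquad U(0)=U_0,\qquad \mathcal B U(t-\tau)=f(t)\ \ \forall t\in(0,\tau).$$ Moreover, for all $t\ge 0$, $$U(t)=S(t)U_0+\int_0^t S(t-s)\,[F(U(s))+k\mathcal B U(s-\tau)]\,ds .$$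
   Context: $\mathcal H$ is a Hilbert space with norm $\|\cdot\|_{\mathcal H}$. The operator $\mathcal A$ on $\mathcal H$ generates a $C_0$-semigroup $(S(t))_{t\ge0}$ that is exponentially stable: there are constants $M,\omega>0$ with $\|S(t)\|_{\mathcal L(\mathcal H)}\le Me^{-\omega t}$ for all $t\ge0$. The delay $\tau>0$ is fixed, $\mathcal B\in\mathcal L(\mathcal H)$ is a bounded linear operator, and $k\in\mathbb R$ is a parameter. For $s\in(0,\tau)$ the symbol $\mathcal B U(s-\tau)$ stands for the prescribed function $f(s)$. A mild solution is a function $U\in C([0,+\infty),\mathcal H)$ satisfying the integral (Duhamel) formula in the claim, with this convention. *)

theory Defs
  imports "HOL-Analysis.Analysis"
begin

text \<open>
  A semigroup is a function on \<open>real\<close>, of which only the values at \<open>t \<ge> 0\<close> are constrained.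
\<close>

definition C0_semigroup :: "(real \<Rightarrow> 'a::real_normed_vector \<Rightarrow>\<^sub>L 'a) \<Rightarrow> bool" where
  "C0_semigroup S \<longleftrightarrow>
     S 0 = id_blinfun \<and>
     (\<forall>s\<ge>0. \<forall>t\<ge>0. S (s + t) = S s o\<^sub>L S t) \<and>
     (\<forall>x. ((\<lambda>t. S t x) \<longlongrightarrow> x) (at_right 0))"

text \<open>
  An unbounded operator is given by its domain \<open>D\<close> and a function \<open>A\<close>, whose values
  outside \<open>D\<close> are irrelevant.  The domain of the generator consists of exactly those \<open>x\<close>
  for which the difference quotient converges.
\<close>

definition generates :: "'a set \<Rightarrow> ('a \<Rightarrow> 'a) \<Rightarrow> (real \<Rightarrow> 'a::real_normed_vector \<Rightarrow>\<^sub>L 'a) \<Rightarrow> bool" where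
  "generates D A S \<longleftrightarrow>
     C0_semigroup S \<and>
     D = {x. \<exists>y. ((\<lambda>h. (S h x - x) /\<^sub>R h) \<longlongrightarrow> y) (at_right 0)} \<and>
     (\<forall>x\<in>D. ((\<lambda>h. (S h x - x) /\<^sub>R h) \<longlongrightarrow> A x) (at_right 0))"

definition exponentially_stable :: "(real \<Rightarrow> 'a::real_normed_vector \<Rightarrow>\<^sub>L 'a) \<Rightarrow> bool" where
  "exponentially_stable S \<longleftrightarrow>
     (\<exists>M>0. \<exists>\<omega>>0. \<forall>t\<ge>0. norm (S t) \<le> M * exp (- \<omega> * t))"

text \<open>
  The expression \<open>B U(s - \<tau>)\<close>, which stands for the prescribed \<open>f s\<close> as long as \<open>s < \<tau>\<close>.
\<close>

definition delay_term ::
  "real \<Rightarrow> ('a::real_normed_vector \<Rightarrow>\<^sub>L 'a) \<Rightarrow> (real \<Rightarrow> 'a) \<Rightarrow> (real \<Rightarrow> 'a) \<Rightarrow> real \<Rightarrow> 'a" where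
  "delay_term \<tau> B f U s = (if s < \<tau> then f s else B (U (s - \<tau>)))"

definition duhamel_integrand ::
  "(real \<Rightarrow> 'a::real_normed_vector \<Rightarrow>\<^sub>L 'a) \<Rightarrow> ('a \<Rightarrow> 'a) \<Rightarrow> real \<Rightarrow> ('a \<Rightarrow>\<^sub>L 'a) \<Rightarrow> real \<Rightarrow>
     (real \<Rightarrow> 'a) \<Rightarrow> (real \<Rightarrow> 'a) \<Rightarrow> real \<Rightarrow> real \<Rightarrow> 'a" where
  "duhamel_integrand S F k B \<tau> f U t s = S (t - s) (F (U s) + k *\<^sub>R delay_term \<tau> B f U s)"

text \<open>
  The integral is the vector-valued gauge integral, which does not require separability of the
  space; the integrand is continuous on \<open>{0..t}\<close> except for a possible jump at \<open>\<tau>\<close>, so this is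
  an ordinary Riemann integral.
\<close>

definition mild_solution ::
  "(real \<Rightarrow> 'a::real_normed_vector \<Rightarrow>\<^sub>L 'a) \<Rightarrow> ('a \<Rightarrow> 'a) \<Rightarrow> real \<Rightarrow> ('a \<Rightarrow>\<^sub>L 'a) \<Rightarrow> real \<Rightarrow>
     'a \<Rightarrow> (real \<Rightarrow> 'a) \<Rightarrow> (real \<Rightarrow> 'a) \<Rightarrow> bool" where
  "mild_solution S F k B \<tau> U0 f U \<longleftrightarrow>
     continuous_on {0..} U \<and>
     (\<forall>t\<ge>0. duhamel_integrand S F k B \<tau> f U t integrable_on {0..t} \<and>
            U t = S t U0 + integral {0..t} (duhamel_integrand S F k B \<tau> f U t))"

end

theory Submission
  imports Defs
begin

text \<open>
  Write \<open>\<Phi> U\<close> for the right-hand side of the Duhamel formula, so that mild solutions are the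
  continuous fixed points of \<open>\<Phi>\<close>.  The source term \<open>F (U s) + k B U (s - \<tau>)\<close> depends in a
  Lipschitz way on \<open>U\<close> restricted to \<open>[0, s]\<close>: the delay merely makes it look at an earlier
  value, and for \<open>s < \<tau>\<close> the delayed value is prescribed and cancels in differences.  With
  \<open>K = \<gamma> + \<bar>k\<bar> \<parallel>B\<parallel>\<close> and \<open>\<parallel>S t\<parallel> \<le> M\<close>, a bound \<open>\<parallel>U r - V r\<parallel> \<le> c exp (L r)\<close> on \<open>[0, t]\<close> therefore
  gives
  \<open>\<parallel>\<Phi> U t - \<Phi> V t\<parallel> \<le> M K c \<integral>\<^sub>0\<^sup>t exp (L s) ds \<le> (M K / L) c exp (L t)\<close>.
  For \<open>L = 2 M K\<close> the factor is \<open>1/2\<close> (\<open>duhamel_contraction\<close>).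

  This one estimate settles both existence and uniqueness, on the whole half-line at once and
  without advancing by steps of length \<open>\<tau>\<close>.  Existence is Banach's fixed point theorem in the
  space of functions \<open>U\<close> with \<open>exp (- L t) U t\<close> bounded and continuous
  (\<open>ex_mild_solution\<close>).  An arbitrary mild solution need not lie in that space a priori, so
  uniqueness applies the estimate on \<open>[0, t]\<close>, with \<open>c\<close> the maximum of the weighted difference of
  two solutions: then \<open>c \<le> c/2\<close>, hence \<open>c = 0\<close> (\<open>mild_solution_unique\<close>).

  What remains is that \<open>\<Phi>\<close> preserves continuity.  The source term may jump at \<open>\<tau>\<close>, where \<open>f \<tau>\<close>
  and \<open>B U0\<close> need not agree.  The integral is split there, and each part is an integral of a
  jointly continuous function with continuously moving endpoints (\<open>convolution_jump\<close>).
\<close>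

section \<open>Gauge integrals with values in a Hilbert space\<close>

text \<open>
  The basic facts about Henstock--Kurzweil integrals of continuous functions concern values in a
  type of class \<open>banach\<close>, whereas a Hilbert space is here a type of sort
  \<open>{real_inner, complete_space}\<close>.  The Riesz map \<open>x \<mapsto> (y \<mapsto> x \<bullet> y)\<close> embeds such a space linearly
  and isometrically into its dual, and the dual is of class \<open>banach\<close>.  Integrals are moved there
  and back.
\<close>

lemma norm_blinfun_inner_right: "norm (blinfun_inner_right x) = norm x"
proof (rule antisym)
  show "norm (blinfun_inner_right x) \<le> norm x"
    by (rule norm_blinfun_bound) (auto simp: Cauchy_Schwarz_ineq2)
  have "norm x * norm x = \<bar>blinfun_inner_right x x\<bar>"
    by (simp add: dot_square_norm power2_eq_square)
  also have "\<dots> \<le> norm (blinfun_inner_right x) * norm x"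
    using norm_blinfun[of "blinfun_inner_right x" x] by simp
  finally show "norm x \<le> norm (blinfun_inner_right x)"
    by (cases "x = 0") auto
qed

lemma bounded_linear_blinfun_inner_right: "bounded_linear blinfun_inner_right"
  by (rule bounded_linear_intro[where K = 1])
    (auto intro!: blinfun_eqI simp: norm_blinfun_inner_right blinfun.bilinear_simps inner_simps)

lemmas linear_blinfun_inner_right = bounded_linear.linear[OF bounded_linear_blinfun_inner_right]
lemmas blinfun_inner_right_add = linear_add[OF linear_blinfun_inner_right]
lemmas blinfun_inner_right_diff = linear_diff[OF linear_blinfun_inner_right]

lemma Riemann_sum_inner_right:
  "(\<Sum>(x, k)\<in>p. measure lborel k *\<^sub>R blinfun_inner_right (g x)) =
   blinfun_inner_right (\<Sum>(x, k)\<in>p. measure lborel k *\<^sub>R g x)"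
  by (simp add: linear_sum[OF linear_blinfun_inner_right]
      linear_scale[OF linear_blinfun_inner_right] case_prod_unfold)

text \<open>
  The Riesz map commutes with Riemann sums and preserves their distance to the integral.
\<close>

lemma has_integral_inner_right_iff:
  fixes g :: "real \<Rightarrow> 'a::real_inner"
  shows "((\<lambda>s. blinfun_inner_right (g s)) has_integral blinfun_inner_right y) {a..b} \<longleftrightarrow>
    (g has_integral y) {a..b}"
  unfolding has_integral_real Riemann_sum_inner_right
  by (simp add: norm_blinfun_inner_right flip: blinfun_inner_right_diff)

text \<open>
  The integral in the dual is a limit of Riemann sums, which lie in the range of the Riesz map.
  This range is complete, being an isometric image of a complete space, hence closed.  So the
  integral comes from a vector of the original space.
\<close>

lemma integrable_inner_rightD:
  fixes g :: "real \<Rightarrow> 'a::{real_inner, complete_space}"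
  assumes "(\<lambda>s. blinfun_inner_right (g s)) integrable_on {a..b}"
  shows "g integrable_on {a..b}"
proof -
  obtain I where I: "((\<lambda>s. blinfun_inner_right (g s)) has_integral I) {a..b}"
    using assms by blast
  have "\<exists>y\<in>range blinfun_inner_right. dist y I < e" if "e > 0" for e
  proof -
    obtain d where "gauge d" and d: "\<And>p. p tagged_division_of {a..b} \<Longrightarrow> d fine p \<Longrightarrow>
        norm ((\<Sum>(x, k)\<in>p. measure lborel k *\<^sub>R blinfun_inner_right (g x)) - I) < e"
      using I \<open>e > 0\<close> unfolding has_integral_real by meson
    moreover obtain p where "p tagged_division_of {a..b}" "d fine p"
      using fine_division_exists_real[OF \<open>gauge d\<close>] by blast
    ultimately show ?thesis
      unfolding Riemann_sum_inner_right dist_norm by blast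
  qed
  moreover have "complete (range (blinfun_inner_right :: 'a \<Rightarrow> _))"
    by (rule complete_isometric_image[of 1])
      (auto simp: norm_blinfun_inner_right complete_UNIV bounded_linear_blinfun_inner_right)
  ultimately have "I \<in> range blinfun_inner_right"
    using closure_approachable[of I] complete_imp_closed closure_closed by blast
  then show ?thesis
    using I has_integral_inner_right_iff by blast
qed

lemma integrable_continuous_hilbert:
  fixes g :: "real \<Rightarrow> 'a::{real_inner, complete_space}"
  assumes "continuous_on {a..b} g"
  shows "g integrable_on {a..b}"
  by (intro integrable_inner_rightD integrable_continuous_interval assms
      bounded_linear.continuous_on[OF bounded_linear_blinfun_inner_right])

lemma has_integral_combine_hilbert:
  fixes g :: "real \<Rightarrow> 'a::real_inner"
  assumes "a \<le> c" "c \<le> b" "(g has_integral i) {a..c}" "(g has_integral j) {c..b}"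
  shows "(g has_integral (i + j)) {a..b}"
proof -
  have "((\<lambda>s. blinfun_inner_right (g s)) has_integral
      (blinfun_inner_right i + blinfun_inner_right j)) {a..b}"
    using assms by (intro has_integral_combine[of a c b]) (auto simp: has_integral_inner_right_iff)
  then show ?thesis
    by (simp add: has_integral_inner_right_iff flip: blinfun_inner_right_add)
qed

lemma integral_norm_bound_integral_hilbert:
  fixes g :: "real \<Rightarrow> 'a::real_inner"
  assumes "g integrable_on {a..b}" "\<phi> integrable_on {a..b}"
    and "\<And>s. s \<in> {a..b} \<Longrightarrow> norm (g s) \<le> \<phi> s"
  shows "norm (integral {a..b} g) \<le> integral {a..b} \<phi>"
proof -
  have *: "((\<lambda>s. blinfun_inner_right (g s)) has_integral
      blinfun_inner_right (integral {a..b} g)) {a..b}"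
    using assms(1) by (simp add: has_integral_inner_right_iff integrable_integral)
  then have "norm (integral {a..b} g) = norm (integral {a..b} (\<lambda>s. blinfun_inner_right (g s)))"
    by (simp add: integral_unique norm_blinfun_inner_right)
  also have "\<dots> \<le> integral {a..b} \<phi>"
    using * assms by (intro integral_norm_bound_integral) (auto simp: norm_blinfun_inner_right)
  finally show ?thesis .
qed

lemma continuous_on_slice:
  assumes "continuous_on X (\<lambda>(t, s). h t s)" "\<And>s. s \<in> Y \<Longrightarrow> (t, s) \<in> X"
  shows "continuous_on Y (h t)"
proof -
  have "continuous_on Y (\<lambda>s. (t, s))"
    by (intro continuous_intros)
  from continuous_on_compose2[OF assms(1) this] assms(2) show ?thesis
    by (auto simp: image_subset_iff)
qed

lemma integral_continuous_on_param_hilbert: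
  fixes h :: "'b::topological_space \<Rightarrow> real \<Rightarrow> 'a::{real_inner, complete_space}"
  assumes "continuous_on (T \<times> {a..b}) (\<lambda>(t, s). h t s)"
  shows "continuous_on T (\<lambda>t. integral {a..b} (h t))"
proof -
  have *: "integral {a..b} (\<lambda>s. blinfun_inner_right (h t s)) =
      blinfun_inner_right (integral {a..b} (h t))" if "t \<in> T" for t
  proof -
    have "continuous_on {a..b} (h t)"
      using that by (intro continuous_on_slice[OF assms]) auto
    then show ?thesis
      by (intro integral_unique)
        (simp add: has_integral_inner_right_iff integrable_continuous_hilbert integrable_integral)
  qed
  have "continuous_on T (\<lambda>t. integral (cbox a b) (\<lambda>s. blinfun_inner_right (h t s)))"
    using bounded_linear.continuous_on[OF bounded_linear_blinfun_inner_right assms]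
    by (intro integral_continuous_on_param) (simp add: case_prod_unfold)
  then have "continuous_on T (\<lambda>t. blinfun_inner_right (integral {a..b} (h t)))"
    by (simp add: * cong: continuous_on_cong)
  then show ?thesis
    by (simp add: continuous_on tendsto_iff dist_norm norm_blinfun_inner_right
        flip: blinfun_inner_right_diff)
qed

text \<open>
  Rescaling to a fixed interval turns dependence of the endpoints on a parameter into dependence
  of the integrand.
\<close>

lemma integral_unit_interval:
  fixes g :: "real \<Rightarrow> 'a::{real_inner, complete_space}"
  assumes "a \<le> b" "continuous_on {a..b} g"
  shows "integral {a..b} g = (b - a) *\<^sub>R integral {0..1} (\<lambda>\<sigma>. g ((b - a) * \<sigma> + a))"
proof (cases "a = b")
  case False
  have "(g has_integral integral {a..b} g) {a..b}"
    using assms by (intro integrable_integral integrable_continuous_hilbert)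
  then have "((\<lambda>\<sigma>. g ((b - a) * \<sigma> + a)) has_integral integral {a..b} g /\<^sub>R (b - a)) {0..1}"
    using has_integral_affinity'[of g "integral {a..b} g" a b "b - a" a] assms(1) False by simp
  then show ?thesis
    using False by (simp add: integral_unique)
qed simp

lemma continuous_on_integral_moving_bounds:
  fixes h :: "real \<Rightarrow> real \<Rightarrow> 'a::{real_inner, complete_space}"
  assumes "continuous_on T a" "continuous_on T b" and ab: "\<And>t. t \<in> T \<Longrightarrow> a t \<le> b t"
    and h: "continuous_on {(t, s). t \<in> T \<and> a t \<le> s \<and> s \<le> b t} (\<lambda>(t, s). h t s)"
  shows "continuous_on T (\<lambda>t. integral {a t..b t} (h t))"
proof -
  have ineq: "a t \<le> (b t - a t) * \<sigma> + a t \<and> (b t - a t) * \<sigma> + a t \<le> b t"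
    if "t \<in> T" "\<sigma> \<in> {0..1}" for t \<sigma>
    using ab[OF that(1)] that(2) mult_left_le[of \<sigma> "b t - a t"] by (auto simp: mult.commute)
  have eq: "integral {a t..b t} (h t) =
      (b t - a t) *\<^sub>R integral {0..1} (\<lambda>\<sigma>. h t ((b t - a t) * \<sigma> + a t))" if "t \<in> T" for t
    using that by (intro integral_unit_interval ab continuous_on_slice[OF h]) auto
  have "continuous_on (T \<times> {0..1}) (\<lambda>x. (fst x, (b (fst x) - a (fst x)) * snd x + a (fst x)))"
    by (intro continuous_intros continuous_on_compose2[OF assms(1)]
        continuous_on_compose2[OF assms(2)]) auto
  then have "continuous_on (T \<times> {0..1}) (\<lambda>(t, \<sigma>). h t ((b t - a t) * \<sigma> + a t))"
    using continuous_on_compose2[OF h, of "T \<times> {0..1}"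
        "\<lambda>x. (fst x, (b (fst x) - a (fst x)) * snd x + a (fst x))"] ineq
    by (simp add: case_prod_unfold image_subset_iff)
  then have "continuous_on T
      (\<lambda>t. (b t - a t) *\<^sub>R integral {0..1} (\<lambda>\<sigma>. h t ((b t - a t) * \<sigma> + a t)))"
    by (intro continuous_intros assms integral_continuous_on_param_hilbert)
  then show ?thesis
    by (simp add: eq cong: continuous_on_cong)
qed


section \<open>Bounded strongly continuous semigroups\<close>

locale bounded_C0_semigroup =
  fixes S :: "real \<Rightarrow> 'a::real_normed_vector \<Rightarrow>\<^sub>L 'a" and M :: real
  assumes C0: "C0_semigroup S" and norm_le: "t \<ge> 0 \<Longrightarrow> norm (S t) \<le> M"
begin

lemma M_nonneg: "M \<ge> 0"
  using norm_le[of 0] norm_ge_zero[of "S 0"] by linarith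

lemma norm_apply_le: "t \<ge> 0 \<Longrightarrow> norm (S t x) \<le> M * norm x"
  by (meson norm_blinfun norm_le mult_right_mono norm_ge_zero order_trans)

text \<open>
  The smaller time factors out of the increment by the semigroup law.  So the right continuity
  at \<open>0\<close> controls both one-sided limits at every time, the left one by boundedness of \<open>S\<close>.
\<close>

lemma orbit_increment_le:
  assumes "0 \<le> s" "0 \<le> t"
  shows "norm (S t x - S s x) \<le> M * norm (S \<bar>t - s\<bar> x - x)"
proof -
  have "norm (S (r + h) x - S r x) \<le> M * norm (S h x - x)" if "r \<ge> 0" "h \<ge> 0" for r h
  proof -
    have "S (r + h) x - S r x = S r (S h x - x)"
      using C0 that by (simp add: C0_semigroup_def blinfun.diff_right)
    then show ?thesis
      by (simp add: norm_apply_le that)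
  qed
  from this[of s "t - s"] this[of t "s - t"] show ?thesis
    using assms by (cases "s \<le> t") (auto simp: norm_minus_commute)
qed

lemma continuous_on_orbit: "continuous_on {0..} (\<lambda>t. S t x)"
  unfolding continuous_on_iff
proof (intro ballI allI impI)
  fix t e :: real assume "t \<in> {0..}" "e > 0"
  have "((\<lambda>h. M * norm (S h x - x)) \<longlongrightarrow> M * norm (x - x)) (at_right 0)"
    using C0 by (intro tendsto_intros) (simp add: C0_semigroup_def)
  then have "\<forall>\<^sub>F h in at_right 0. M * norm (S h x - x) < e"
    using \<open>e > 0\<close> by (intro order_tendstoD) auto
  then obtain d where "d > 0" and d: "\<And>h. 0 < h \<Longrightarrow> h < d \<Longrightarrow> M * norm (S h x - x) < e"
    unfolding eventually_at_right_field by blast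
  have "dist (S s x) (S t x) < e" if "s \<in> {0..}" "dist s t < d" for s
  proof (cases "s = t")
    case False
    with d[of "\<bar>s - t\<bar>"] orbit_increment_le[of t s x] that \<open>t \<in> {0..}\<close> show ?thesis
      by (simp add: dist_norm)
  qed (use \<open>e > 0\<close> in simp)
  with \<open>d > 0\<close> show "\<exists>d>0. \<forall>s\<in>{0..}. dist s t < d \<longrightarrow> dist (S s x) (S t x) < e"
    by blast
qed

text \<open>
  Strong continuity together with the uniform bound gives joint continuity of \<open>(t, x) \<mapsto> S t x\<close>:
  split \<open>S (r p) (g p) = S (r p) (g p - g q) + S (r p) (g q)\<close>.
\<close>

lemma continuous_on_apply:
  assumes r: "continuous_on T r" and g: "continuous_on T g" and nonneg: "\<And>p. p \<in> T \<Longrightarrow> r p \<ge> 0"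
  shows "continuous_on T (\<lambda>p. S (r p) (g p))"
  unfolding continuous_on_def
proof
  fix q assume "q \<in> T"
  have "((\<lambda>p. M * norm (g p - g q)) \<longlongrightarrow> M * norm (g q - g q)) (at q within T)"
    using g \<open>q \<in> T\<close> by (intro tendsto_intros) (simp add: continuous_on_def)
  moreover have "\<forall>\<^sub>F p in at q within T. norm (S (r p) (g p - g q)) \<le> M * norm (g p - g q)"
    by (auto simp: eventually_at_filter intro!: always_eventually norm_apply_le nonneg)
  ultimately have "((\<lambda>p. S (r p) (g p - g q)) \<longlongrightarrow> 0) (at q within T)"
    by (auto intro: Lim_null_comparison)
  moreover have "((\<lambda>p. S (r p) (g q)) \<longlongrightarrow> S (r q) (g q)) (at q within T)"
    using continuous_on_compose2[OF continuous_on_orbit r, of "g q"] nonneg \<open>q \<in> T\<close>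
    by (auto simp: continuous_on_def)
  ultimately have "((\<lambda>p. S (r p) (g p - g q) + S (r p) (g q)) \<longlongrightarrow> 0 + S (r q) (g q)) (at q within T)"
    by (rule tendsto_add)
  then show "((\<lambda>p. S (r p) (g p)) \<longlongrightarrow> S (r q) (g q)) (at q within T)"
    by (simp add: blinfun.diff_right)
qed

end


section \<open>Convolutions with the semigroup\<close>

locale hilbert_semigroup = bounded_C0_semigroup S M
  for S :: "real \<Rightarrow> 'a::{real_inner, complete_space} \<Rightarrow>\<^sub>L 'a" and M
begin

text \<open>
  Both pieces are taken continuous on the whole half-line, so that after splitting at
  \<open>min t \<tau>\<close> each integrand is jointly continuous in \<open>(t, s)\<close> on its triangular domain.  For
  \<open>t \<le> \<tau>\<close> the second integral is over a point.
\<close>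

lemma convolution_jump:
  fixes \<tau> :: real
  assumes "\<tau> > 0" and g: "continuous_on {0..} g1" "continuous_on {0..} g2"
  defines "g \<equiv> \<lambda>s. if s < \<tau> then g1 s else g2 s"
  shows convolution_jump_integrable:
      "t \<ge> 0 \<Longrightarrow> (\<lambda>s. S (t - s) (g s)) integrable_on {0..t}" (is "_ \<Longrightarrow> ?int t")
    and convolution_jump_continuous:
      "continuous_on {0..} (\<lambda>t. integral {0..t} (\<lambda>s. S (t - s) (g s)))" (is ?cont)
proof -
  define m where "m t = min t \<tau>" for t :: real
  have m: "0 \<le> m t" "m t \<le> t" "m t \<le> \<tau>" if "t \<ge> 0" for t
    using that \<open>\<tau> > 0\<close> by (auto simp: m_def)
  have conv: "continuous_on X (\<lambda>(t, s). S (t - s) (g' s))"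
    if "continuous_on {0..} g'" "\<And>t s. (t, s) \<in> X \<Longrightarrow> 0 \<le> s \<and> s \<le> t" for g' X
    unfolding case_prod_unfold using that
    by (intro continuous_on_apply continuous_intros continuous_on_compose2[OF that(1)]) auto
  have slice: "(\<lambda>s. S (t - s) (g' s)) integrable_on {a..b}"
    if "continuous_on {0..} g'" "0 \<le> a" "b \<le> t" for g' t a b
    using that
    by (intro integrable_continuous_hilbert continuous_on_apply continuous_intros
        continuous_on_subset[OF that(1)]) auto
  have main: "((\<lambda>s. S (t - s) (g s)) has_integral
      (integral {0..m t} (\<lambda>s. S (t - s) (g1 s)) + integral {m t..t} (\<lambda>s. S (t - s) (g2 s)))) {0..t}"
    if t: "t \<ge> 0" for t
  proof (rule has_integral_combine_hilbert[OF m(1)[OF t] m(2)[OF t]])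
    \<comment> \<open>If \<open>t \<ge> \<tau>\<close>, then \<open>g\<close> and \<open>g1\<close> may differ at the right endpoint \<open>\<tau>\<close>.\<close>
    show "((\<lambda>s. S (t - s) (g s)) has_integral integral {0..m t} (\<lambda>s. S (t - s) (g1 s))) {0..m t}"
      using m[OF t]
      by (intro has_integral_spike_finite[OF _ _ integrable_integral[OF slice[OF g(1)]],
            of "{\<tau>}"]) (auto simp: g_def)
    \<comment> \<open>If \<open>t < \<tau>\<close>, the interval is \<open>{t}\<close>, where \<open>g\<close> and \<open>g2\<close> may differ.\<close>
    show "((\<lambda>s. S (t - s) (g s)) has_integral integral {m t..t} (\<lambda>s. S (t - s) (g2 s))) {m t..t}"
      using m[OF t]
      by (intro has_integral_spike_finite[OF _ _ integrable_integral[OF slice[OF g(2)]],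
            of "{t}"]) (auto simp: g_def m_def split: if_splits)
  qed
  show "?int t" if "t \<ge> 0" for t
    using main[OF that] by blast
  have "continuous_on {0..} m"
    unfolding m_def by (intro continuous_intros)
  then have "continuous_on {0..} (\<lambda>t. integral {0..m t} (\<lambda>s. S (t - s) (g1 s)) +
      integral {m t..t} (\<lambda>s. S (t - s) (g2 s)))"
    using m g by (intro continuous_intros continuous_on_integral_moving_bounds conv) force+
  then show ?cont
    by (rule continuous_on_eq) (simp add: integral_unique[OF main])
qed

lemma norm_convolution_le:
  assumes "L > 0" "c \<ge> 0" "(\<lambda>s. S (t - s) (g s)) integrable_on {0..t}" "t \<ge> 0"
    and g: "\<And>s. s \<in> {0..t} \<Longrightarrow> norm (g s) \<le> c * exp (L * s)"
  shows "norm (integral {0..t} (\<lambda>s. S (t - s) (g s))) \<le> M * c / L * exp (L * t)"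
proof -
  have I: "((\<lambda>s. M * c * exp (L * s)) has_integral
      (M * c / L * exp (L * t) - M * c / L * exp (L * 0))) {0..t}"
    using \<open>L > 0\<close> \<open>t \<ge> 0\<close>
    by (intro fundamental_theorem_of_calculus)
      (auto intro!: derivative_eq_intros simp flip: has_real_derivative_iff_has_vector_derivative)
  have "norm (integral {0..t} (\<lambda>s. S (t - s) (g s))) \<le> integral {0..t} (\<lambda>s. M * c * exp (L * s))"
  proof (intro integral_norm_bound_integral_hilbert assms)
    show "norm (S (t - s) (g s)) \<le> M * c * exp (L * s)" if "s \<in> {0..t}" for s
      using norm_apply_le[of "t - s" "g s"] mult_left_mono[OF g[OF that] M_nonneg] that
      by (simp add: mult.assoc)
  qed (use I in blast)
  also have "\<dots> \<le> M * c / L * exp (L * t)"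
    using M_nonneg \<open>L > 0\<close> \<open>c \<ge> 0\<close> by (subst integral_unique[OF I]) simp
  finally show ?thesis .
qed

end


section \<open>The fixed point equation\<close>

locale delay_problem = hilbert_semigroup S M
  for S :: "real \<Rightarrow> 'a::{real_inner, complete_space} \<Rightarrow>\<^sub>L 'a" and M +
  fixes F :: "'a \<Rightarrow> 'a" and B :: "'a \<Rightarrow>\<^sub>L 'a" and \<tau> k \<gamma> :: real and U0 :: 'a and f :: "real \<Rightarrow> 'a"
  assumes M_pos: "M > 0" and \<tau>_pos: "\<tau> > 0" and \<gamma>_pos: "\<gamma> > 0"
    and F_lipschitz: "\<gamma>-lipschitz_on UNIV F" and f_cont: "continuous_on {0..\<tau>} f"
begin

definition forcing :: "(real \<Rightarrow> 'a) \<Rightarrow> real \<Rightarrow> 'a" where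
  "forcing U s = F (U s) + k *\<^sub>R delay_term \<tau> B f U s"

definition duhamel :: "(real \<Rightarrow> 'a) \<Rightarrow> real \<Rightarrow> 'a" where
  "duhamel U t = S t U0 + integral {0..t} (\<lambda>s. S (t - s) (forcing U s))"

text \<open>
  The Lipschitz constant of \<open>forcing\<close> with respect to the supremum over the past.
\<close>

definition K :: real where "K = \<gamma> + \<bar>k\<bar> * norm B"

text \<open>
  The growth rate of the exponential weight; the factor \<open>2\<close> makes the contraction constant \<open>1/2\<close>.
\<close>

definition L :: real where "L = 2 * M * K"

lemma K_pos: "K > 0"
  using \<gamma>_pos by (simp add: K_def add_pos_nonneg)

lemma L_pos: "L > 0"
  using K_pos M_pos by (simp add: L_def)

lemma mild_solution_iff:
  "mild_solution S F k B \<tau> U0 f U \<longleftrightarrow> continuous_on {0..} U \<and>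
    (\<forall>t\<ge>0. (\<lambda>s. S (t - s) (forcing U s)) integrable_on {0..t} \<and> U t = duhamel U t)"
  unfolding mild_solution_def duhamel_integrand_def[abs_def] duhamel_def forcing_def ..

lemma
  assumes U: "continuous_on {0..} U"
  shows forcing_integrable: "t \<ge> 0 \<Longrightarrow> (\<lambda>s. S (t - s) (forcing U s)) integrable_on {0..t}"
    and continuous_on_duhamel: "continuous_on {0..} (duhamel U)"
proof -
  \<comment> \<open>Clamping the arguments extends the two branches of the delay term continuously to the half-line.\<close>
  let ?g1 = "\<lambda>s. F (U s) + k *\<^sub>R f (min s \<tau>)"
  let ?g2 = "\<lambda>s. F (U s) + k *\<^sub>R B (U (max (s - \<tau>) 0))"
  have "continuous_on UNIV F"
    by (rule lipschitz_on_continuous_on[OF F_lipschitz])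
  then have FU: "continuous_on {0..} (\<lambda>s. F (U s))"
    using U continuous_on_compose2 by blast
  have g1: "continuous_on {0..} ?g1"
    using \<tau>_pos
    by (intro continuous_intros FU continuous_on_compose2[OF f_cont]) auto
  have g2: "continuous_on {0..} ?g2"
    by (intro continuous_intros FU continuous_on_compose2[OF U] blinfun.continuous_on) auto
  have eq: "forcing U = (\<lambda>s. if s < \<tau> then ?g1 s else ?g2 s)"
    by (auto simp: forcing_def delay_term_def)
  show "t \<ge> 0 \<Longrightarrow> (\<lambda>s. S (t - s) (forcing U s)) integrable_on {0..t}"
    unfolding eq by (rule convolution_jump_integrable[OF \<tau>_pos g1 g2])
  show "continuous_on {0..} (duhamel U)"
    unfolding duhamel_def[abs_def] eq
    by (intro continuous_intros continuous_on_orbit convolution_jump_continuous[OF \<tau>_pos g1 g2])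
qed

text \<open>
  For \<open>s < \<tau>\<close> the delay terms of \<open>U\<close> and \<open>V\<close> coincide.  For \<open>s \<ge> \<tau>\<close> they look at time
  \<open>s - \<tau>\<close>, where the increasing weight \<open>exp (L r)\<close> is smaller still.
\<close>

lemma forcing_diff_le:
  assumes "s \<ge> 0" and close: "\<And>r. r \<in> {0..s} \<Longrightarrow> norm (U r - V r) \<le> c * exp (L * r)"
  shows "norm (forcing U s - forcing V s) \<le> K * c * exp (L * s)"
proof -
  define e where "e = c * exp (L * s)"
  have UV: "norm (U s - V s) \<le> e"
    using close[of s] \<open>s \<ge> 0\<close> by (simp add: e_def)
  have "norm (U 0 - V 0) \<le> c"
    using close[of 0] \<open>s \<ge> 0\<close> by simp
  then have "c \<ge> 0"
    using norm_ge_zero order_trans by blast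
  have F: "norm (F (U s) - F (V s)) \<le> \<gamma> * e"
    using lipschitz_onD[OF F_lipschitz, of "U s" "V s"] \<gamma>_pos
    by (intro order_trans[OF _ mult_left_mono[OF UV]]) (auto simp: dist_norm)
  have D: "norm (delay_term \<tau> B f U s - delay_term \<tau> B f V s) \<le> norm B * e"
  proof (cases "s < \<tau>")
    case False
    have "norm (U (s - \<tau>) - V (s - \<tau>)) \<le> c * exp (L * (s - \<tau>))"
      using False \<tau>_pos by (intro close) auto
    also have "\<dots> \<le> e"
      using \<tau>_pos L_pos \<open>c \<ge> 0\<close> by (auto simp: e_def intro!: mult_left_mono)
    finally have "norm B * norm (U (s - \<tau>) - V (s - \<tau>)) \<le> norm B * e"
      by (intro mult_left_mono) auto
    then show ?thesis
      using False norm_blinfun[of B "U (s - \<tau>) - V (s - \<tau>)"]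
      by (simp add: delay_term_def blinfun.diff_right)
  qed (use \<open>c \<ge> 0\<close> in \<open>simp add: delay_term_def e_def\<close>)
  have "forcing U s - forcing V s =
      (F (U s) - F (V s)) + k *\<^sub>R (delay_term \<tau> B f U s - delay_term \<tau> B f V s)"
    by (simp add: forcing_def algebra_simps)
  also have "norm \<dots> \<le> \<gamma> * e + \<bar>k\<bar> * (norm B * e)"
    using F mult_left_mono[OF D, of "\<bar>k\<bar>"] by (intro norm_triangle_mono) auto
  finally show ?thesis
    by (simp add: K_def e_def algebra_simps)
qed

text \<open>
  The bound in \<open>forcing_diff_le\<close> is integrated against \<open>\<parallel>S\<parallel> \<le> M\<close>, and \<open>M K / L = 1/2\<close>.  Closeness is
  measured on \<open>[0, t]\<close> alone, so that the estimate serves the fixed point theorem as well as the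
  uniqueness among all continuous solutions, whatever their growth at infinity.
\<close>

lemma duhamel_contraction:
  assumes "continuous_on {0..} U" "continuous_on {0..} V" "t \<ge> 0"
    and close: "\<And>r. r \<in> {0..t} \<Longrightarrow> norm (U r - V r) \<le> c * exp (L * r)"
  shows "norm (duhamel U t - duhamel V t) \<le> c / 2 * exp (L * t)"
proof -
  have "norm (U 0 - V 0) \<le> c"
    using close[of 0] \<open>t \<ge> 0\<close> by simp
  then have "c \<ge> 0"
    using norm_ge_zero order_trans by blast
  have int: "(\<lambda>s. S (t - s) (forcing U s)) integrable_on {0..t}"
    "(\<lambda>s. S (t - s) (forcing V s)) integrable_on {0..t}"
    using assms forcing_integrable by auto
  have "duhamel U t - duhamel V t = integral {0..t} (\<lambda>s. S (t - s) (forcing U s - forcing V s))"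
    using integral_diff[OF int] by (simp add: duhamel_def blinfun.diff_right)
  also have "norm \<dots> \<le> M * (K * c) / L * exp (L * t)"
    using integrable_diff[OF int] \<open>c \<ge> 0\<close> K_pos close \<open>t \<ge> 0\<close>
    by (intro norm_convolution_le forcing_diff_le L_pos) (auto simp: blinfun.diff_right)
  also have "M * (K * c) / L = c / 2"
    using M_pos K_pos by (simp add: L_def)
  finally show ?thesis .
qed

text \<open>
  One function with weighted bounded image is enough: the contraction estimate then bounds the
  image of every other function in the weighted space.
\<close>

lemma duhamel_zero_growth: "\<exists>C. \<forall>t\<ge>0. norm (duhamel (\<lambda>_. 0) t) \<le> C * exp (L * t)"
proof -
  have "compact (f ` {0..\<tau>})"
    by (intro compact_continuous_image f_cont) auto
  then obtain b where "b > 0" and b: "\<And>s. s \<in> {0..\<tau>} \<Longrightarrow> norm (f s) \<le> b"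
    using compact_imp_bounded bounded_pos[of "f ` {0..\<tau>}"] by auto
  define c where "c = norm (F 0) + \<bar>k\<bar> * b"
  have "c \<ge> 0"
    using \<open>b > 0\<close> by (simp add: c_def)
  have "norm (duhamel (\<lambda>_. 0) t) \<le> (M * norm U0 + M * c / L) * exp (L * t)" if "t \<ge> 0" for t
  proof -
    have exp: "exp (L * s) \<ge> 1" if "s \<ge> 0" for s
      using L_pos that by simp
    have forcing: "norm (forcing (\<lambda>_. 0) s) \<le> c * exp (L * s)" if "s \<in> {0..t}" for s
    proof -
      have "norm (delay_term \<tau> B f (\<lambda>_. 0) s) \<le> b"
        using b[of s] \<open>b > 0\<close> that by (simp add: delay_term_def)
      then have "norm (forcing (\<lambda>_. 0) s) \<le> c"
        unfolding forcing_def c_def by (intro norm_triangle_mono) (auto intro: mult_left_mono)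
      then show ?thesis
        using mult_left_mono[OF exp[of s] \<open>c \<ge> 0\<close>] that by simp
    qed
    have "norm (S t U0) \<le> M * norm U0 * exp (L * t)"
      using norm_apply_le[OF that, of U0]
        mult_left_mono[OF exp[OF that], of "M * norm U0"] M_nonneg by simp
    moreover have "norm (integral {0..t} (\<lambda>s. S (t - s) (forcing (\<lambda>_. 0) s))) \<le>
        M * c / L * exp (L * t)"
      using that forcing
      by (intro norm_convolution_le L_pos \<open>c \<ge> 0\<close> forcing_integrable continuous_intros) auto
    ultimately show ?thesis
      unfolding duhamel_def distrib_right by (rule norm_triangle_mono)
  qed
  then show ?thesis
    by blast
qed

definition unweight :: "(real \<Rightarrow>\<^sub>C 'a) \<Rightarrow> real \<Rightarrow> 'a" where
  "unweight u t = exp (L * t) *\<^sub>R u t"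

text \<open>
  The weighted space is represented by bounded continuous functions \<open>u\<close> on the whole line, with
  \<open>U t = exp (L t) u t\<close>.  Only \<open>t \<ge> 0\<close> matters, so negative times repeat the value at \<open>0\<close>.
\<close>

definition weighted_duhamel :: "(real \<Rightarrow>\<^sub>C 'a) \<Rightarrow> real \<Rightarrow> 'a" where
  "weighted_duhamel u t = exp (- (L * max t 0)) *\<^sub>R duhamel (unweight u) (max t 0)"

lemma continuous_on_unweight: "continuous_on X (unweight u)"
  unfolding unweight_def[abs_def] by (intro continuous_intros continuous_on_apply_bcontfun)

lemma duhamel_unweight_diff_le:
  assumes "t \<ge> 0"
  shows "norm (duhamel (unweight u) t - duhamel (unweight v) t) \<le> dist u v / 2 * exp (L * t)"
proof (intro duhamel_contraction continuous_on_unweight assms)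
  fix r
  have "unweight u r - unweight v r = exp (L * r) *\<^sub>R (u r - v r)"
    by (simp add: unweight_def scaleR_diff_right)
  then show "norm (unweight u r - unweight v r) \<le> dist u v * exp (L * r)"
    using dist_bounded[of u r v] by (simp add: dist_norm)
qed

lemma weighted_norm_le:
  fixes x :: 'a
  assumes "norm x \<le> c * exp y"
  shows "norm (exp (- y) *\<^sub>R x) \<le> c"
  using assms by (simp add: exp_minus field_simps)

lemma weighted_duhamel_bcontfun: "weighted_duhamel u \<in> bcontfun"
proof -
  obtain C where C: "\<And>t. t \<ge> 0 \<Longrightarrow> norm (duhamel (\<lambda>_. 0) t) \<le> C * exp (L * t)"
    using duhamel_zero_growth by blast
  have "unweight 0 = (\<lambda>_. 0)"
    by (auto simp: unweight_def)
  then have "norm (duhamel (unweight u) t) \<le> (C + dist u 0 / 2) * exp (L * t)" if "t \<ge> 0" for t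
    using norm_triangle_mono[OF C[OF that] duhamel_unweight_diff_le[OF that, of u 0]]
    by (simp add: distrib_right)
  then have bound: "norm (weighted_duhamel u t) \<le> C + dist u 0 / 2" for t
    unfolding weighted_duhamel_def by (intro weighted_norm_le) simp
  have "continuous_on UNIV (weighted_duhamel u)"
    unfolding weighted_duhamel_def[abs_def]
    by (intro continuous_intros
        continuous_on_compose2[OF continuous_on_duhamel[OF continuous_on_unweight]]) auto
  then show ?thesis
    using bound by (rule bcontfun_normI)
qed

lemma ex_mild_solution: "\<exists>U. mild_solution S F k B \<tau> U0 f U"
proof -
  let ?P = "\<lambda>u. Bcontfun (weighted_duhamel u)"
  have P: "apply_bcontfun (?P u) = weighted_duhamel u" for u
    by (rule Bcontfun_inverse[OF weighted_duhamel_bcontfun])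
  have "dist (?P u) (?P v) \<le> 1 / 2 * dist u v" for u v
  proof (rule dist_bound)
    fix t
    have "norm (weighted_duhamel u t - weighted_duhamel v t) \<le> dist u v / 2"
      unfolding weighted_duhamel_def scaleR_diff_right[symmetric]
      by (intro weighted_norm_le duhamel_unweight_diff_le) simp
    then show "dist (?P u t) (?P v t) \<le> 1 / 2 * dist u v"
      by (simp add: P dist_norm)
  qed
  then obtain u where u: "?P u = u"
    using banach_fix_type[of "1 / 2" ?P] by auto
  have "unweight u t = duhamel (unweight u) t" if "t \<ge> 0" for t
  proof -
    have "u t = exp (- (L * t)) *\<^sub>R duhamel (unweight u) t"
      using that P[of u] by (simp add: u weighted_duhamel_def)
    then show ?thesis
      by (simp add: unweight_def[of u t] flip: exp_add)
  qed
  then have "mild_solution S F k B \<tau> U0 f (unweight u)"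
    by (simp add: mild_solution_iff continuous_on_unweight forcing_integrable)
  then show ?thesis
    by blast
qed

text \<open>
  The weighted difference \<open>w\<close> attains its maximum over \<open>[0, t]\<close> at some \<open>m\<close>.  The contraction
  estimate at \<open>m\<close> gives \<open>w m \<le> w m / 2\<close>, so \<open>w\<close> vanishes.
\<close>

lemma mild_solution_unique:
  assumes "mild_solution S F k B \<tau> U0 f U" "mild_solution S F k B \<tau> U0 f V" "t \<ge> 0"
  shows "V t = U t"
proof -
  have cont: "continuous_on {0..} U" "continuous_on {0..} V"
    and fix_pt: "\<And>s. s \<ge> 0 \<Longrightarrow> U s = duhamel U s" "\<And>s. s \<ge> 0 \<Longrightarrow> V s = duhamel V s"
    using assms by (auto simp: mild_solution_iff)
  define w where "w s = exp (- (L * s)) * norm (U s - V s)" for s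
  have "continuous_on {0..t} w"
    unfolding w_def[abs_def]
    by (intro continuous_intros continuous_on_subset[OF cont(1)] continuous_on_subset[OF cont(2)])
      auto
  then obtain m where m: "m \<in> {0..t}" and max: "\<And>s. s \<in> {0..t} \<Longrightarrow> w s \<le> w m"
    using continuous_attains_sup[of "{0..t}" w] \<open>t \<ge> 0\<close> by auto
  have diff: "norm (U s - V s) = w s * exp (L * s)" for s
    by (simp add: w_def exp_minus)
  have "norm (duhamel U m - duhamel V m) \<le> w m / 2 * exp (L * m)"
    using m max by (intro duhamel_contraction cont) (auto simp: diff)
  then have "w m * exp (L * m) \<le> w m / 2 * exp (L * m)"
    using fix_pt m by (simp flip: diff)
  then have "w m \<le> 0"
    unfolding mult_le_cancel_right_pos[OF exp_gt_zero] by simp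
  then have "w t \<le> 0"
    using max[of t] \<open>t \<ge> 0\<close> by simp
  then show ?thesis
    by (simp add: w_def mult_le_0_iff)
qed

end

theorem proposition2p1:
  fixes D :: "'a::{real_inner, complete_space} set"
    and A :: "'a \<Rightarrow> 'a"
    and S :: "real \<Rightarrow> 'a \<Rightarrow>\<^sub>L 'a"
    and B :: "'a \<Rightarrow>\<^sub>L 'a"
    and F :: "'a \<Rightarrow> 'a"
    and \<tau> k \<gamma> :: real
    and U0 :: 'a
    and f :: "real \<Rightarrow> 'a"
  assumes "generates D A S"
    and "exponentially_stable S"
    and "\<tau> > 0"
    and "F 0 = 0"
    and "\<gamma> > 0"
    and "\<gamma>-lipschitz_on UNIV F"
    and "continuous_on {0..\<tau>} f"
  shows "\<exists>U. mild_solution S F k B \<tau> U0 f U \<and>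
             (\<forall>V. mild_solution S F k B \<tau> U0 f V \<longrightarrow> (\<forall>t\<ge>0. V t = U t)) \<and>
             U 0 = U0 \<and>
             (\<forall>t\<ge>0. U t = S t U0 +
                integral {0..t} (\<lambda>s. S (t - s) (F (U s) + k *\<^sub>R delay_term \<tau> B f U s)))"
proof -
  have C0: "C0_semigroup S"
    using assms(1) by (simp add: generates_def)
  obtain M \<omega> where "M > 0" "\<omega> > 0" and M: "\<And>t. t \<ge> 0 \<Longrightarrow> norm (S t) \<le> M * exp (- \<omega> * t)"
    using assms(2) unfolding exponentially_stable_def by blast
  have "norm (S t) \<le> M" if "t \<ge> 0" for t
  proof -
    have "M * exp (- \<omega> * t) \<le> M * 1"
      using that \<open>M > 0\<close> \<open>\<omega> > 0\<close> by (intro mult_left_mono) auto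
    then show ?thesis
      using M[OF that] by simp
  qed
  then interpret delay_problem S M F B \<tau> k \<gamma> U0 f
    using assms C0 \<open>M > 0\<close> by unfold_locales
  obtain U where U: "mild_solution S F k B \<tau> U0 f U"
    using ex_mild_solution by blast
  have duhamel: "U t = S t U0 +
      integral {0..t} (\<lambda>s. S (t - s) (F (U s) + k *\<^sub>R delay_term \<tau> B f U s))" if "t \<ge> 0" for t
    using U that unfolding mild_solution_iff duhamel_def forcing_def by blast
  have "U 0 = U0"
    using duhamel[of 0] C0 by (simp add: C0_semigroup_def)
  with U duhamel show ?thesis
    using mild_solution_unique[OF U] by blast
qed

end
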